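(* Let $\eta\in(0,1)$, assume $\widetilde J\beta^*\ne0$, and let $$\lambda_n=16\,\sigma\sqrt{\frac{\log\left(p/\sqrt{\eta p/(1+p)}\right)}{n}},\qquad\mu_n=\frac{\lambda_n}{4|\widetilde J\beta^*|_\infty}.$$ Suppose that the following hold. (RE) There is a constant $\phi_{\mu_n}>0$ such that $\Delta'K_n\Delta\ge\phi_{\mu_n}\sum_{j\in\mathcal{A}^*}\Delta_j^2$ for any $\Delta\in\mathbb{R}^p$ with $\sum_{j\notin\mathcal{A}^*}|\Delta_j|\le4\sum_{j\in\mathcal{A}^*}|\Delta_j|$. (C) With $\varrho_n=4\sqrt{|\mathcal{A}^*|}+\frac{4\mu_n}{\lambda_n}|\widetilde J\beta^*|_2$ and $\tilde c=2(\phi'_{\mu_n})^{-1}\left(1+\frac{\varrho_n}{\sqrt m}\right)$, $$\min_{j\in\mathcal{A}^*}|\beta_j^*|>2\tilde c\left(\lambda_n\sqrt{|\mathcal{A}^*|}+\mu_n|\widetilde J\beta^*|_2\right),$$ where $m\ge 1$ is the integer and $\phi'_{\mu_n}>0$ the constant in the following condition: $\mathcal{B}\supset\mathcal{A}^*$ is a subset of $\{1,\dots,p\}$ with $|\mathcal{B}|\le c_{\widetilde J}|\mathcal{A}^*|$ for a constant $c_{\widetilde J}\ge1$ and $\beta^{*\prime}\widetilde J u=\beta_{\mathcal{B}}^{*\prime}\widetilde J u_{\mathcal{B}}$ for every $u\in\mathbb{R}^p$, $m+|\mathcal{B}|<p$, $\mathcal{C}$ is the index set of the $m$ largest components in absolute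 value of $\beta^*-\hat\beta^{Quad}$ outside $\mathcal{B}$, and $\Delta'K_n\Delta\ge\phi'_{\mu_n}\sum_{j\in\mathcal{B}\cup\mathcal{C}}\Delta_j^2$ for any $\Delta\in\mathbb{R}^p$ with $\sum_{j\notin\mathcal{B}}|\Delta_j|\le\varrho_n\sqrt{\sum_{j\in\mathcal{B}}\Delta_j^2}$. (D) $\displaystyle\max_{j\in\mathcal{A}^*}\max_{k\notin\mathcal{A}^*}|(K_n)_{j,k}|\le\frac{t}{|\mathcal{A}^*|}$, where $t$ is a positive term smaller than $\frac{\phi_{\mu_n}}{64}$, with $\phi_{\mu_n}$ the constant in (RE). Then $$\mathbb{P}(\hat{\mathcal{A}}\nsubseteq\mathcal{A}^* )\le\eta\qquad\text{and}\qquad\mathbb{P}\left(\mathrm{sign}(\hat\beta^{Quad})=\mathrm{sign}(\beta^* )\right)\ge1-\eta.$$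
   Context: Linear regression model: $n,p\ge 1$ are integers, $X\in\mathbb{R}^{n\times p}$ is a deterministic design matrix with entries $x_{i,j}$, whose columns are normalized so that $n^{-1}\sum_{i=1}^n x_{i,j}^2=1$ for every $j=1,\dots,p$; $\beta^*\in\mathbb{R}^p$ is the unknown parameter and $Y=X\beta^*+\varepsilon$, where $\varepsilon=(\varepsilon_1,\dots,\varepsilon_n)'$ has i.i.d. centered Gaussian entries with known variance $\sigma^2>0$. The sparsity set is $\mathcal{A}^*=\{j:\beta_j^*\ne 0\}$. Notation: $'$ is transposition; $\|a\|_n^2=n^{-1}\sum_{i=1}^n a_i^2$ for $a\in\mathbb{R}^n$; $|\cdot|_q$ is the usual $\ell_q$ norm of a vector ($|\cdot|_\infty$ the sup-norm) and $|S|$ the cardinality of a finite set $S$; for $a\in\mathbb{R}^p$ and $\Theta\subset\{1,\dots,p\}$, $a_\Theta\in\mathbb{R}^p$ has $(a_\Theta)_j=a_j$ if $j\in\Theta$ and $0$ otherwise; $\mathrm{sign}$ of a vector is taken componentwise, with $\mathrm{sign}(0)=0$. $\mathbf{J}$ is a given real $d\times p$ matrix ($d\ge1$) and $\widetilde J=\mathbf{J}'\mathbf{J}$. For $\lambda_n,\mu_n>0$, the estimator $\hat\beta^{Quad}$ is a solution of $$\min_{\beta\in\mathbb{R}^p}\left\{\|Y-X\beta\|_n^2+\lambda_n|\beta|_1+\mu_n\beta'\mathbf{J}'\mathbf{J}\beta\right\}.$$ $\hat{\mathcal{A}}=\{j:\hat\beta_j^{Quad}\ne0\}$ is the set of indices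 of non-zero components of $\hat\beta^{Quad}$. Finally $\Psi^n=n^{-1}X'X$ and $K_n=\Psi^n+\mu_n\widetilde J$. *)

theory Defs
  imports "HOL-Probability.Probability"
begin

definition support :: "real ^ 'p \<Rightarrow> 'p set" where
  "support v = {j. v $ j \<noteq> 0}"

definition l1norm :: "real ^ 'p \<Rightarrow> real" where
  "l1norm v = (\<Sum>j\<in>UNIV. \<bar>v $ j\<bar>)"

definition empnorm_sq :: "real ^ 'n \<Rightarrow> real" where
  "empnorm_sq a = (\<Sum>i\<in>UNIV. (a $ i)\<^sup>2) / real CARD('n)"

definition restrict_vec :: "real ^ 'p \<Rightarrow> 'p set \<Rightarrow> real ^ 'p" where
  "restrict_vec a \<Theta> = (\<chi> j. if j \<in> \<Theta> then a $ j else 0)"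

text \<open>The componentwise sign. On vectors, the library's \<^const>\<open>sgn\<close> is the normalisation
  of a vector to unit length, so it cannot be used directly.\<close>

definition sign_vec :: "real ^ 'p \<Rightarrow> real ^ 'p" where
  "sign_vec v = (\<chi> j. sgn (v $ j))"

definition gram :: "real ^ 'p ^ 'd \<Rightarrow> real ^ 'p ^ 'p" where
  "gram J = transpose J ** J"

definition K_mat :: "real ^ 'p ^ 'n \<Rightarrow> real ^ 'p ^ 'd \<Rightarrow> real \<Rightarrow> real ^ 'p ^ 'p" where
  "K_mat X J \<mu> = (1 / real CARD('n)) *\<^sub>R gram X + \<mu> *\<^sub>R gram J"

definition quad_criterion ::
  "real ^ 'p ^ 'n \<Rightarrow> real ^ 'p ^ 'd \<Rightarrow> real \<Rightarrow> real \<Rightarrow> real ^ 'n \<Rightarrow> real ^ 'p \<Rightarrow> real" where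
  "quad_criterion X J lam \<mu> y \<beta> =
     empnorm_sq (y - X *v \<beta>) + lam * l1norm \<beta> + \<mu> * (\<beta> \<bullet> (gram J *v \<beta>))"

text \<open>Minimisers need not be unique, so being a solution is a property of a vector.\<close>

definition is_quad_solution ::
  "real ^ 'p ^ 'n \<Rightarrow> real ^ 'p ^ 'd \<Rightarrow> real \<Rightarrow> real \<Rightarrow> real ^ 'n \<Rightarrow> real ^ 'p \<Rightarrow> bool" where
  "is_quad_solution X J lam \<mu> y \<beta> \<longleftrightarrow> is_arg_min (quad_criterion X J lam \<mu> y) (\<lambda>_. True) \<beta>"

text \<open>\<open>C\<close> consists of indices of the \<open>m\<close> largest components in absolute value of \<open>v\<close>
  outside \<open>B\<close>; ties may be broken in any way.\<close>

definition largest_outside :: "nat \<Rightarrow> real ^ 'p \<Rightarrow> 'p set \<Rightarrow> 'p set \<Rightarrow> bool" where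
  "largest_outside m v B C \<longleftrightarrow>
     C \<subseteq> - B \<and> card C = m \<and> (\<forall>j\<in>C. \<forall>k\<in>- B - C. \<bar>v $ k\<bar> \<le> \<bar>v $ j\<bar>)"

end

theory Submission
  imports Defs
begin

text \<open>
  Write \<open>\<Delta>\<close> for the estimation error, \<open>A\<close> for the support of the true parameter and \<open>V\<close> for the
  vector of correlations \<open>X'\<epsilon>/n\<close> between the columns of the design and the noise.
  Randomness enters only through the event that every \<open>\<bar>V\<^sub>j\<bar>\<close> is below \<open>lam / 8\<close>. A Chernoff
  bound (\<open>score_uniform_tail\<close>) makes its complement have probability at most
  \<open>2 * p * exp (- 2 * L) = 2 * \<eta> / (1 + p) \<le> \<eta>\<close>, where \<open>L\<close> is the logarithm in the definition
  of \<open>lam\<close>. On this event both conclusions are shown deterministically.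

  First-order optimality of the estimator is used as a variational inequality
  (\<open>quad_solution_variational\<close>): the convex quadratic part of the criterion has gradient
  \<open>2 * (K \<Delta> - w)\<close> at the estimator, with \<open>w = V - \<mu> * J'J \<beta>s\<close>, and comparing with the segment
  towards any competitor bounds the directional derivative by the change of the penalty. The
  choice of \<open>\<mu>\<close> makes \<open>\<mu> * \<bar>(J'J \<beta>s)\<^sub>j\<bar> \<le> lam / 4\<close>, hence \<open>\<bar>w\<^sub>j\<bar> \<le> 3 / 8 * lam\<close>, which stays
  below the subgradient level \<open>lam / 2\<close>. Three competitors are used.

  \<^item> The true parameter: \<open>\<Delta>\<close> lies in a cone, its \<open>l\<^sub>1\<close> mass off \<open>A\<close> being at most \<open>7\<close> times that
    on \<open>A\<close>.
  \<^item> The estimator with its coordinates on \<open>A\<close> replaced by the true ones: an upper bound for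
    \<open>\<Delta>\<^sub>A \<bullet> K \<Delta>\<close>. Up to a cross term this is \<open>\<Delta>\<^sub>A \<bullet> K \<Delta>\<^sub>A\<close>, which the restricted eigenvalue
    condition for the vector \<open>\<Delta>\<^sub>A\<close> bounds below. The cone and the coherence condition
    control the cross term, and a bound of order \<open>lam * card A / \<phi>\<close> for the \<open>l\<^sub>1\<close> norm of \<open>\<Delta>\<^sub>A\<close> follows.
  \<^item> The estimator with its coordinates off \<open>A\<close> set to zero: a nonzero mass off \<open>A\<close> would have to
    be paid for by the cross term alone, which is too small by coherence and the previous bound.

  This gives the inclusion of the supports (\<open>support_contained\<close>). For the signs
  (\<open>lasso_signs\<close>), the first competitor is used again, now with the Euclidean norm for the
  structured bias \<open>J'J \<beta>s\<close>, which vanishes outside \<open>B\<close>. It puts \<open>\<Delta>\<close> in the cone of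
  the second eigenvalue condition, which bounds every coordinate of \<open>\<Delta>\<close> on \<open>A\<close>; the minimal
  size of the true coefficients exceeds this bound.
\<close>

section \<open>Coordinates and quadratic forms\<close>

lemma restrict_vec_nth [simp]: "restrict_vec a S $ j = (if j \<in> S then a $ j else 0)"
  by (simp add: restrict_vec_def)

lemma restrict_vec_UNIV [simp]: "restrict_vec a UNIV = a"
  by (simp add: vec_eq_iff)

lemma restrict_vec_add_Compl: "restrict_vec a S + restrict_vec a (- S) = a"
  by (simp add: vec_eq_iff)

lemma inner_restrict_vec: "restrict_vec a S \<bullet> b = (\<Sum>j\<in>S. a $ j * b $ j)"
  by (simp add: inner_vec_def if_distrib[of "\<lambda>x. x * _"] sum.If_cases cong: if_cong)

lemma sum_split_Compl:
  fixes f :: "'p::finite \<Rightarrow> real"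
  shows "(\<Sum>j\<in>UNIV. f j) = (\<Sum>j\<in>S. f j) + (\<Sum>j\<in>- S. f j)"
  by (metis finite Compl_partition Compl_disjoint inf_commute sum.union_disjoint disjoint_eq_subset_Compl order_refl)

lemma l1norm_restrict_vec: "l1norm (restrict_vec a S) = (\<Sum>j\<in>S. \<bar>a $ j\<bar>)"
  by (simp add: l1norm_def if_distrib[of abs] sum.If_cases cong: if_cong)

lemma norm_restrict_vec: "norm (restrict_vec a S) = sqrt (\<Sum>j\<in>S. (a $ j)\<^sup>2)"
  by (simp add: norm_eq_sqrt_inner inner_restrict_vec power2_eq_square)

lemma inner_gram: "x \<bullet> (gram A *v y) = (A *v x) \<bullet> (A *v y)"
  for A :: "real ^ 'p ^ 'd"
  unfolding gram_def
  by (metis dot_lmul_matrix matrix_vector_mul_assoc transpose_transpose vector_transpose_matrix)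

lemma inner_K_mat:
  fixes X :: "real ^ 'p ^ 'n"
  shows "x \<bullet> (K_mat X J \<mu> *v y)
    = ((X *v x) \<bullet> (X *v y)) / real CARD('n) + \<mu> * ((J *v x) \<bullet> (J *v y))"
  by (simp add: K_mat_def matrix_vector_mult_add_rdistrib inner_add_right inner_gram
      scaleR_matrix_vector_assoc[symmetric])

lemma inner_le_max_coefficient:
  assumes "\<And>j. j \<in> S \<Longrightarrow> \<bar>w $ j\<bar> \<le> c"
  shows "restrict_vec d S \<bullet> w \<le> c * (\<Sum>j\<in>S. \<bar>d $ j\<bar>)"
proof -
  have "d $ j * w $ j \<le> c * \<bar>d $ j\<bar>" if "j \<in> S" for j
  proof -
    have "d $ j * w $ j \<le> \<bar>d $ j\<bar> * \<bar>w $ j\<bar>" by (metis abs_ge_self abs_mult)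
    also have "\<dots> \<le> \<bar>d $ j\<bar> * c" using assms[OF that] by (intro mult_left_mono) auto
    finally show ?thesis by (simp add: mult.commute)
  qed
  then show ?thesis by (simp add: inner_restrict_vec sum_distrib_left sum_mono)
qed

lemma inner_matrix_vector:
  fixes K :: "real ^ 'p ^ 'p"
  shows "restrict_vec a S \<bullet> (K *v restrict_vec b T)
    = (\<Sum>j\<in>S. \<Sum>k\<in>T. a $ j * K $ j $ k * b $ k)"
  by (simp add: inner_restrict_vec matrix_vector_mult_def sum_distrib_left mult.assoc
      if_distrib[of "\<lambda>x. _ * x"] sum.If_cases cong: if_cong)

lemma cross_term_bound:
  fixes K :: "real ^ 'p ^ 'p"
  assumes "\<And>j k. j \<in> S \<Longrightarrow> k \<in> T \<Longrightarrow> \<bar>K $ j $ k\<bar> \<le> \<kappa>"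
  shows "\<bar>restrict_vec a S \<bullet> (K *v restrict_vec b T)\<bar>
    \<le> \<kappa> * (\<Sum>j\<in>S. \<bar>a $ j\<bar>) * (\<Sum>k\<in>T. \<bar>b $ k\<bar>)"
proof -
  have "\<bar>restrict_vec a S \<bullet> (K *v restrict_vec b T)\<bar>
      \<le> (\<Sum>j\<in>S. \<Sum>k\<in>T. \<bar>a $ j * K $ j $ k * b $ k\<bar>)"
    unfolding inner_matrix_vector by (intro order_trans[OF sum_abs] sum_mono sum_abs)
  also have "\<dots> \<le> (\<Sum>j\<in>S. \<Sum>k\<in>T. \<kappa> * (\<bar>a $ j\<bar> * \<bar>b $ k\<bar>))"
  proof (intro sum_mono)
    fix j k assume "j \<in> S" "k \<in> T"
    then have "\<bar>K $ j $ k\<bar> * (\<bar>a $ j\<bar> * \<bar>b $ k\<bar>) \<le> \<kappa> * (\<bar>a $ j\<bar> * \<bar>b $ k\<bar>)"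
      by (intro mult_right_mono assms) auto
    then show "\<bar>a $ j * K $ j $ k * b $ k\<bar> \<le> \<kappa> * (\<bar>a $ j\<bar> * \<bar>b $ k\<bar>)"
      by (simp add: abs_mult mult_ac)
  qed
  finally show ?thesis by (simp add: sum_distrib_left sum_distrib_right mult_ac)
qed

lemma transpose_K_mat: "transpose (K_mat X J \<mu>) = K_mat X J \<mu>"
  by (simp add: vec_eq_iff transpose_def K_mat_def gram_def matrix_matrix_mult_def mult.commute)

lemma K_mat_nonneg:
  fixes X :: "real ^ 'p ^ 'n"
  assumes "\<mu> \<ge> 0"
  shows "x \<bullet> (K_mat X J \<mu> *v x) \<ge> 0"
  using assms by (simp add: inner_K_mat)

section \<open>First-order optimality of the estimator\<close>

text \<open>The correlations between the columns of \<open>X\<close> and the noise; twice this vector is the noise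
  part of the negative gradient of the least squares term.\<close>

definition score :: "real ^ 'p ^ 'n \<Rightarrow> real ^ 'n \<Rightarrow> real ^ 'p" where
  "score X e = (1 / real CARD('n)) *\<^sub>R (transpose X *v e)"

lemma score_nth: "score X e $ j = (\<Sum>i\<in>UNIV. X $ i $ j / real CARD('n) * e $ i)"
  for X :: "real ^ 'p ^ 'n"
  by (simp add: score_def matrix_vector_mult_def transpose_def sum_divide_distrib)

lemma score_inner: "score X e \<bullet> h = (e \<bullet> (X *v h)) / real CARD('n)"
  for X :: "real ^ 'p ^ 'n"
  by (simp add: score_def dot_lmul_matrix flip: vector_transpose_matrix)

text \<open>The first factor of the inner product is half the negative gradient of the quadratic part of
  the criterion at the minimiser. Along the segment from the minimiser to a competitor \<open>b\<close>, the
  quadratic part changes by its linear term up to an error of second order, and by convexity the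
  penalty changes by at most the proportional share of its total change. Dividing by the step
  length and letting it tend to zero gives the claim. This replaces the
  subgradient (Karush-Kuhn-Tucker) conditions, and each later use is one choice of \<open>b\<close>.\<close>

lemma quad_solution_variational:
  fixes X :: "real ^ 'p ^ 'n" and J :: "real ^ 'p ^ 'd" and bs bh b :: "real ^ 'p"
  assumes sol: "is_quad_solution X J lam \<mu> (X *v bs + e) bh" and lam: "lam \<ge> 0"
  shows "2 * ((score X e - \<mu> *\<^sub>R (gram J *v bs) - K_mat X J \<mu> *v (bh - bs)) \<bullet> (b - bh))
    \<le> lam * (l1norm b - l1norm bh)"
proof -
  define h where "h = b - bh"
  define q where "q = h \<bullet> (K_mat X J \<mu> *v h)"
  define g where
    "g = 2 * ((score X e - \<mu> *\<^sub>R (gram J *v bs) - K_mat X J \<mu> *v (bh - bs)) \<bullet> h)"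
  define n where "n = real CARD('n)"
  have n: "n > 0" by (simp add: n_def)
  have emp: "empnorm_sq a = (a \<bullet> a) / n" for a :: "real ^ 'n"
    by (simp add: empnorm_sq_def inner_vec_def power2_eq_square n_def)
  \<comment> \<open>everything in terms of images under \<open>X\<close> and \<open>J\<close>, the form in which the criterion expands\<close>
  have g_eq: "g = 2 * ((e \<bullet> (X *v h)) / n - \<mu> * ((J *v bs) \<bullet> (J *v h))
      - (X *v h) \<bullet> (X *v (bh - bs)) / n - \<mu> * ((J *v h) \<bullet> (J *v (bh - bs))))"
    unfolding g_def inner_diff_left score_inner n_def inner_scaleR_left
    by (simp add: inner_commute[of _ h] inner_gram inner_K_mat inner_commute[of "J *v h"])
  have step: "g \<le> lam * (l1norm b - l1norm bh) + \<tau> * q" if \<tau>: "0 < \<tau>" "\<tau> \<le> 1" for \<tau>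
  proof -
    have split: "X *v bs + e - X *v (bh + \<tau> *\<^sub>R h)
        = (e - X *v (bh - bs)) - \<tau> *\<^sub>R (X *v h)"
      by (simp add: matrix_vector_right_distrib matrix_vector_mult_diff_distrib
          matrix_vector_mult_scaleR)
    have split0: "X *v bs + e - X *v bh = e - X *v (bh - bs)"
      by (simp add: matrix_vector_mult_diff_distrib)
    have "quad_criterion X J lam \<mu> (X *v bs + e) (bh + \<tau> *\<^sub>R h) - lam * l1norm (bh + \<tau> *\<^sub>R h)
        = quad_criterion X J lam \<mu> (X *v bs + e) bh - lam * l1norm bh - \<tau> * g + \<tau>\<^sup>2 * q"
      unfolding quad_criterion_def split split0 inner_gram emp g_eq q_def inner_K_mat
        n_def[symmetric]
      using n
      by (simp add: matrix_vector_right_distrib matrix_vector_mult_diff_distrib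
          matrix_vector_mult_scaleR inner_add_left inner_add_right inner_diff_left
          inner_diff_right inner_commute field_simps power2_eq_square)
    moreover have "quad_criterion X J lam \<mu> (X *v bs + e) bh
        \<le> quad_criterion X J lam \<mu> (X *v bs + e) (bh + \<tau> *\<^sub>R h)"
      using sol by (simp add: is_quad_solution_def is_arg_min_linorder)
    moreover have "l1norm (bh + \<tau> *\<^sub>R h) \<le> (1 - \<tau>) * l1norm bh + \<tau> * l1norm b"
    proof -
      have "\<bar>(bh + \<tau> *\<^sub>R h) $ j\<bar> \<le> (1 - \<tau>) * \<bar>bh $ j\<bar> + \<tau> * \<bar>b $ j\<bar>" for j
      proof -
        have "(bh + \<tau> *\<^sub>R h) $ j = (1 - \<tau>) * bh $ j + \<tau> * b $ j"
          by (simp add: h_def algebra_simps)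
        then show ?thesis
          using abs_triangle_ineq[of "(1 - \<tau>) * bh $ j" "\<tau> * b $ j"] \<tau> by (simp add: abs_mult)
      qed
      then have "l1norm (bh + \<tau> *\<^sub>R h) \<le> (\<Sum>j\<in>UNIV. (1 - \<tau>) * \<bar>bh $ j\<bar> + \<tau> * \<bar>b $ j\<bar>)"
        unfolding l1norm_def by (intro sum_mono)
      then show ?thesis by (simp add: l1norm_def sum.distrib sum_distrib_left)
    qed
    then have "lam * l1norm (bh + \<tau> *\<^sub>R h) \<le> lam * ((1 - \<tau>) * l1norm bh + \<tau> * l1norm b)"
      using lam by (rule mult_left_mono)
    ultimately have "\<tau> * g \<le> \<tau> * (lam * (l1norm b - l1norm bh) + \<tau> * q)"
      by (simp add: algebra_simps power2_eq_square)
    then show ?thesis using \<tau> by simp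
  qed
  have "g \<le> lam * (l1norm b - l1norm bh)"
  proof (rule field_le_epsilon)
    fix \<delta> :: real assume \<delta>: "\<delta> > 0"
    \<comment> \<open>a step so short that the second order term is at most \<open>\<delta>\<close>\<close>
    define \<tau> where "\<tau> = min 1 (\<delta> / (\<bar>q\<bar> + 1))"
    have \<tau>: "0 < \<tau>" "\<tau> \<le> 1" using \<delta> by (auto simp: \<tau>_def)
    have "\<tau> * q \<le> \<tau> * (\<bar>q\<bar> + 1)"
      using \<tau>(1) by (intro mult_left_mono) auto
    also have "\<dots> \<le> \<delta> / (\<bar>q\<bar> + 1) * (\<bar>q\<bar> + 1)"
      by (intro mult_right_mono) (auto simp: \<tau>_def)
    finally have "\<tau> * q \<le> \<delta>" by simp
    then show "g \<le> lam * (l1norm b - l1norm bh) + \<delta>" using step[OF \<tau>] by linarith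
  qed
  then show ?thesis by (simp add: g_def h_def)
qed

section \<open>Deterministic support and sign recovery\<close>

text \<open>The deterministic part of the argument needs nothing about the estimator beyond the
  variational inequality. Here \<open>bs\<close> is the true parameter, \<open>bh\<close> the estimator, and \<open>w\<close> collects
  noise and bias.\<close>

locale lasso_variational =
  fixes K :: "real ^ 'p ^ 'p" and w bs bh :: "real ^ 'p" and lam :: real
  assumes lam_pos: "lam > 0"
    and variational:
      "\<And>b. 2 * ((w - K *v (bh - bs)) \<bullet> (b - bh)) \<le> lam * (l1norm b - l1norm bh)"
begin

abbreviation A where "A \<equiv> support bs"
abbreviation D where "D \<equiv> bh - bs"

lemma D_off_support: "j \<notin> A \<Longrightarrow> D $ j = bh $ j"
  by (simp add: support_def)

text \<open>The competitor is \<open>bs\<close>: on its support the penalty loses at most the size of the error, off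
  it the penalty of the estimator is exactly the size of the error.\<close>

lemma total_energy:
  "D \<bullet> (K *v D) \<le> w \<bullet> D + lam / 2 * ((\<Sum>j\<in>A. \<bar>D $ j\<bar>) - (\<Sum>j\<in>- A. \<bar>D $ j\<bar>))"
proof -
  have "l1norm bs - l1norm bh
      = (\<Sum>j\<in>A. \<bar>bs $ j\<bar> - \<bar>bh $ j\<bar>) + (\<Sum>j\<in>- A. \<bar>bs $ j\<bar> - \<bar>bh $ j\<bar>)"
    by (simp add: l1norm_def sum_subtractf sum_split_Compl[of _ A])
  also have "\<dots> \<le> (\<Sum>j\<in>A. \<bar>D $ j\<bar>) + (\<Sum>j\<in>- A. - \<bar>D $ j\<bar>)"
    by (intro add_mono sum_mono) (auto simp: support_def)
  finally have "l1norm bs - l1norm bh \<le> (\<Sum>j\<in>A. \<bar>D $ j\<bar>) - (\<Sum>j\<in>- A. \<bar>D $ j\<bar>)"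
    by (simp add: sum_negf)
  then have "lam * (l1norm bs - l1norm bh)
      \<le> lam * ((\<Sum>j\<in>A. \<bar>D $ j\<bar>) - (\<Sum>j\<in>- A. \<bar>D $ j\<bar>))"
    using lam_pos by (intro mult_left_mono) auto
  moreover have "2 * ((w - K *v D) \<bullet> (bs - bh)) = 2 * (D \<bullet> (K *v D)) - 2 * (w \<bullet> D)"
    by (simp add: inner_diff_left inner_diff_right inner_commute)
  ultimately show ?thesis using variational[of bs] by simp
qed

text \<open>The competitor corrects the estimator on the support of \<open>bs\<close> only. The energy that
  this bounds contains the support block of \<open>K\<close>, to which a restricted eigenvalue applies.\<close>

lemma active_energy:
  "restrict_vec D A \<bullet> (K *v D) \<le> restrict_vec D A \<bullet> w + lam / 2 * (\<Sum>j\<in>A. \<bar>D $ j\<bar>)"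
proof -
  define b where "b = bh - restrict_vec D A"
  have "l1norm b \<le> (\<Sum>j\<in>UNIV. \<bar>bh $ j\<bar> + \<bar>restrict_vec D A $ j\<bar>)"
    unfolding l1norm_def b_def by (intro sum_mono) auto
  then have "l1norm b - l1norm bh \<le> (\<Sum>j\<in>A. \<bar>D $ j\<bar>)"
    using l1norm_restrict_vec[of D A] by (simp add: l1norm_def sum.distrib)
  then have "lam * (l1norm b - l1norm bh) \<le> lam * (\<Sum>j\<in>A. \<bar>D $ j\<bar>)"
    using lam_pos by (intro mult_left_mono) auto
  moreover have "2 * ((w - K *v D) \<bullet> (b - bh))
      = 2 * (restrict_vec D A \<bullet> (K *v D)) - 2 * (restrict_vec D A \<bullet> w)"
    by (simp add: b_def inner_diff_left inner_diff_right inner_commute)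
  ultimately show ?thesis using variational[of b] by simp
qed

text \<open>The competitor deletes the coordinates of the estimator off the support of \<open>bs\<close>, so that the
  penalty drops by exactly the deleted \<open>l\<^sub>1\<close> mass.\<close>

lemma inactive_energy:
  "restrict_vec D (- A) \<bullet> (K *v D)
    \<le> restrict_vec D (- A) \<bullet> w - lam / 2 * (\<Sum>j\<in>- A. \<bar>D $ j\<bar>)"
proof -
  define b where "b = bh - restrict_vec D (- A)"
  have "(\<Sum>j\<in>- A. \<bar>bs $ j\<bar>) = 0"
    by (intro sum.neutral) (simp add: support_def)
  then have "l1norm b = (\<Sum>j\<in>A. \<bar>bh $ j\<bar>)"
    unfolding l1norm_def sum_split_Compl[of _ A] b_def by simp
  moreover have "(\<Sum>j\<in>- A. \<bar>bh $ j\<bar>) = (\<Sum>j\<in>- A. \<bar>D $ j\<bar>)"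
    by (intro sum.cong refl arg_cong[of _ _ abs] D_off_support[symmetric]) simp
  ultimately have "l1norm b - l1norm bh = - (\<Sum>j\<in>- A. \<bar>D $ j\<bar>)"
    unfolding l1norm_def sum_split_Compl[of _ A] by linarith
  moreover have "2 * ((w - K *v D) \<bullet> (b - bh))
      = 2 * (restrict_vec D (- A) \<bullet> (K *v D)) - 2 * (restrict_vec D (- A) \<bullet> w)"
    by (simp add: b_def inner_diff_left inner_diff_right inner_commute)
  ultimately show ?thesis using variational[of b] by simp
qed

text \<open>The ratio \<open>7\<close> is \<open>(1/2 + 3/8) / (1/2 - 3/8)\<close>: \<open>w\<close> uses up \<open>3/8\<close> of the \<open>1/2\<close> that the penalty
  provides off the support and adds as much on the support.\<close>

lemma cone:
  assumes K_nonneg: "\<And>x. x \<bullet> (K *v x) \<ge> 0"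
    and w: "\<And>j. \<bar>w $ j\<bar> \<le> 3 / 8 * lam"
  shows "(\<Sum>j\<in>- A. \<bar>D $ j\<bar>) \<le> 7 * (\<Sum>j\<in>A. \<bar>D $ j\<bar>)"
proof -
  have "w \<bullet> D \<le> 3 / 8 * lam * ((\<Sum>j\<in>A. \<bar>D $ j\<bar>) + (\<Sum>j\<in>- A. \<bar>D $ j\<bar>))"
    using inner_le_max_coefficient[of UNIV w "3 / 8 * lam" D] w
    by (simp add: sum_split_Compl[of _ A] inner_commute)
  then have "0 \<le> 3 / 8 * lam * ((\<Sum>j\<in>A. \<bar>D $ j\<bar>) + (\<Sum>j\<in>- A. \<bar>D $ j\<bar>))
      + lam / 2 * ((\<Sum>j\<in>A. \<bar>D $ j\<bar>) - (\<Sum>j\<in>- A. \<bar>D $ j\<bar>))"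
    using total_energy K_nonneg[of D] by linarith
  also have "\<dots> = lam / 8 * (7 * (\<Sum>j\<in>A. \<bar>D $ j\<bar>) - (\<Sum>j\<in>- A. \<bar>D $ j\<bar>))"
    by (simp add: algebra_simps)
  finally show ?thesis using lam_pos by (simp add: zero_le_mult_iff)
qed

text \<open>Let \<open>a\<close> and \<open>c\<close> be the \<open>l\<^sub>1\<close> masses of the error on and off the support. The eigenvalue
  condition is applied to the part of the error on the support, which satisfies every cone
  condition; the price is the cross term \<open>\<kappa> * a * c \<le> 7 * \<kappa> * a\<^sup>2\<close>. By Cauchy-Schwarz,
  \<open>a\<^sup>2\<close> is at most \<open>card A\<close> times the squared Euclidean norm of that part, so the cross term uses
  up only a fraction \<open>7 / 64\<close> of \<open>\<phi>\<close> and \<open>a \<le> 56 / 57 * lam * card A / \<phi>\<close>.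
  Off the support, the penalty has \<open>lam / 8\<close> to spare after \<open>w\<close>. Since \<open>K\<close> is nonnegative
  there, \<open>c > 0\<close> would force \<open>lam / 8 \<le> \<kappa> * a\<close>, against the bounds on \<open>\<kappa>\<close> and \<open>a\<close>.\<close>

lemma support_contained:
  fixes \<phi> \<kappa> :: real
  assumes K_nonneg: "\<And>x. x \<bullet> (K *v x) \<ge> 0"
    and K_sym: "transpose K = K"
    and w: "\<And>j. \<bar>w $ j\<bar> \<le> 3 / 8 * lam"
    and \<phi>: "\<phi> > 0"
    and RE: "\<And>x. support x \<subseteq> A \<Longrightarrow> \<phi> * (\<Sum>j\<in>A. (x $ j)\<^sup>2) \<le> x \<bullet> (K *v x)"
    and coherence: "\<And>j k. j \<in> A \<Longrightarrow> k \<notin> A \<Longrightarrow> \<bar>K $ j $ k\<bar> \<le> \<kappa>"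
    and \<kappa>: "0 \<le> \<kappa>" "64 * card A * \<kappa> < \<phi>"
    and nonempty: "A \<noteq> {}"
  shows "support bh \<subseteq> A"
proof -
  define a where "a = (\<Sum>j\<in>A. \<bar>D $ j\<bar>)"
  define c where "c = (\<Sum>j\<in>- A. \<bar>D $ j\<bar>)"
  define s where "s = real (card A)"
  have s: "s > 0" using nonempty by (simp add: s_def card_gt_0_iff)
  have a: "a \<ge> 0" and c: "c \<ge> 0" by (simp_all add: a_def c_def sum_nonneg)
  define DA where "DA = restrict_vec D A"
  define DC where "DC = restrict_vec D (- A)"
  have D: "D = DA + DC" by (simp add: DA_def DC_def restrict_vec_add_Compl)
  have cross: "\<bar>DA \<bullet> (K *v DC)\<bar> \<le> \<kappa> * a * c"
    unfolding DA_def DC_def a_def c_def using coherence by (intro cross_term_bound) auto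
  have sym: "DC \<bullet> (K *v DA) = DA \<bullet> (K *v DC)"
    by (metis K_sym dot_lmul_matrix inner_commute vector_transpose_matrix)
  have wA: "DA \<bullet> w \<le> 3 / 8 * lam * a" and wC: "DC \<bullet> w \<le> 3 / 8 * lam * c"
    unfolding DA_def DC_def a_def c_def by (intro inner_le_max_coefficient w)+
  have ca: "c \<le> 7 * a" unfolding a_def c_def by (rule cone[OF K_nonneg w])
  have "a\<^sup>2 \<le> s * (\<Sum>j\<in>A. (DA $ j)\<^sup>2)"
    using sum_squared_le_sum_of_squares[of "\<lambda>j. \<bar>D $ j\<bar>" A]
    by (simp add: a_def s_def DA_def mult.commute)
  then have "\<phi> * a\<^sup>2 \<le> \<phi> * (s * (\<Sum>j\<in>A. (DA $ j)\<^sup>2))"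
    using \<phi> by (intro mult_left_mono) auto
  also have "\<dots> = s * (\<phi> * (\<Sum>j\<in>A. (DA $ j)\<^sup>2))" by simp
  also have "\<dots> \<le> s * (DA \<bullet> (K *v DA))"
    using s by (intro mult_left_mono RE) (auto simp: DA_def support_def)
  also have "\<dots> \<le> s * (7 / 8 * lam * a + \<kappa> * a * c)"
  proof -
    have "DA \<bullet> (K *v D) \<le> DA \<bullet> w + lam / 2 * a"
      using active_energy by (simp add: DA_def a_def)
    then have "DA \<bullet> (K *v DA) \<le> 7 / 8 * lam * a + \<kappa> * a * c"
      using wA cross unfolding D matrix_vector_right_distrib inner_add_right by simp
    then show ?thesis using s by (intro mult_left_mono) auto
  qed
  also have "\<dots> \<le> s * (7 / 8 * lam * a + \<kappa> * a * (7 * a))"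
    using s a \<kappa>(1) ca by (intro mult_left_mono add_left_mono) auto
  also have "\<dots> = 7 / 8 * lam * s * a + 7 / 64 * (64 * s * \<kappa>) * a\<^sup>2"
    by (simp add: algebra_simps power2_eq_square)
  also have "\<dots> \<le> 7 / 8 * lam * s * a + 7 / 64 * \<phi> * a\<^sup>2"
    using \<kappa>(2) by (intro add_left_mono mult_right_mono mult_left_mono) (auto simp: s_def)
  finally have "a * (57 * \<phi> * a) \<le> a * (56 * lam * s)"
    by (simp add: algebra_simps power2_eq_square)
  then have a_bound: "57 * \<phi> * a \<le> 56 * lam * s"
    using a lam_pos s by (cases "a = 0") auto
  have "c = 0"
  proof (rule ccontr)
    assume "c \<noteq> 0"
    then have c_pos: "c > 0" using c by simp
    have "DC \<bullet> (K *v D) \<le> DC \<bullet> w - lam / 2 * c"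
      using inactive_energy by (simp add: DC_def c_def)
    then have "DC \<bullet> (K *v DC) - \<kappa> * a * c \<le> - (lam / 8) * c"
      using wC cross sym unfolding D matrix_vector_right_distrib inner_add_right by simp
    then have "lam / 8 * c \<le> \<kappa> * a * c" using K_nonneg[of DC] by simp
    then have "lam / 8 \<le> \<kappa> * a" using c_pos by simp
    then have "57 * \<phi> * (lam / 8) \<le> 57 * \<phi> * (\<kappa> * a)" using \<phi> by (intro mult_left_mono) auto
    also have "\<dots> = \<kappa> * (57 * \<phi> * a)" by simp
    also have "\<dots> \<le> \<kappa> * (56 * lam * s)" using a_bound \<kappa>(1) by (rule mult_left_mono)
    also have "\<dots> = 7 / 8 * lam * (64 * s * \<kappa>)" by simp
    also have "\<dots> \<le> 7 / 8 * lam * \<phi>"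
      using \<kappa>(2) lam_pos by (intro mult_left_mono) (auto simp: s_def)
    finally have "50 * (\<phi> * lam) \<le> 0" by (simp add: algebra_simps)
    then show False using \<phi> lam_pos by (simp add: mult_le_0_iff)
  qed
  then have "\<forall>j\<in>- A. \<bar>D $ j\<bar> = 0" unfolding c_def by (simp add: sum_nonneg_eq_0_iff)
  then show ?thesis by (auto simp: support_def)
qed

end

lemma sgn_eq_if_close:
  fixes x y :: real
  assumes "\<bar>y - x\<bar> < \<bar>x\<bar>"
  shows "sgn y = sgn x"
  using assms by (auto simp: sgn_if abs_if split: if_splits)

text \<open>Here the bias \<open>g\<close> is measured in the Euclidean norm and only the noise \<open>V\<close> coordinatewise.
  As \<open>g\<close> vanishes outside \<open>B\<close>, it contributes at most \<open>norm g * N\<close>, where \<open>N\<close> is the Euclidean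
  norm of the error on \<open>B\<close>. The cone constants that result are \<open>5/3\<close> and \<open>8/3\<close>, both below the \<open>4\<close>
  in \<open>\<rho>\<close>. The eigenvalue condition then turns the energy bound, which is linear in \<open>N\<close>, into a
  bound on \<open>N\<close>, hence on every coordinate of the error in \<open>B\<close>.\<close>

lemma lasso_signs:
  fixes V g bs bh :: "real ^ 'p"
  assumes lv: "lasso_variational K (V - g) bs bh lam"
    and K_nonneg: "\<And>x. x \<bullet> (K *v x) \<ge> 0"
    and V: "\<And>j. \<bar>V $ j\<bar> \<le> lam / 8"
    and B: "support bs \<subseteq> B"
    and g: "\<And>u. g \<bullet> u = g \<bullet> restrict_vec u B"
    and \<rho>: "\<rho> = 4 * sqrt (card (support bs)) + 4 * norm g / lam"
    and \<phi>': "\<phi>' > 0"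
    and RE: "(\<Sum>j\<in>- B. \<bar>(bh - bs) $ j\<bar>) \<le> \<rho> * sqrt (\<Sum>j\<in>B. ((bh - bs) $ j)\<^sup>2)
      \<Longrightarrow> \<phi>' * (\<Sum>j\<in>B. ((bh - bs) $ j)\<^sup>2) \<le> (bh - bs) \<bullet> (K *v (bh - bs))"
    and beta_min: "\<And>j. j \<in> support bs \<Longrightarrow>
      lam * sqrt (card (support bs)) + norm g < \<phi>' * \<bar>bs $ j\<bar>"
    and j: "j \<in> support bs"
  shows "sgn (bh $ j) = sgn (bs $ j)"
proof -
  interpret lasso_variational K "V - g" bs bh lam by (rule lv)
  define a where "a = (\<Sum>j\<in>A. \<bar>D $ j\<bar>)"
  define c where "c = (\<Sum>j\<in>- A. \<bar>D $ j\<bar>)"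
  define N where "N = sqrt (\<Sum>j\<in>B. (D $ j)\<^sup>2)"
  define P where "P = sqrt (card A)"
  have P: "P \<ge> 0" and N: "N \<ge> 0" by (simp_all add: P_def N_def sum_nonneg)
  have N2: "N\<^sup>2 = (\<Sum>j\<in>B. (D $ j)\<^sup>2)" by (simp add: N_def sum_nonneg)
  have aN: "a \<le> P * N"
  proof (rule power2_le_imp_le)
    have "a\<^sup>2 \<le> (\<Sum>j\<in>A. (D $ j)\<^sup>2) * card A"
      using sum_squared_le_sum_of_squares[of "\<lambda>j. \<bar>D $ j\<bar>" A] by (simp add: a_def)
    also have "\<dots> \<le> (\<Sum>j\<in>B. (D $ j)\<^sup>2) * card A"
      using B by (intro mult_right_mono sum_mono2) auto
    finally show "a\<^sup>2 \<le> (P * N)\<^sup>2" by (simp add: power_mult_distrib P_def N2 mult.commute)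
  qed (use P N in simp)
  have VD: "V \<bullet> D \<le> lam / 8 * (a + c)"
    using inner_le_max_coefficient[of UNIV V "lam / 8" D] V
    by (simp add: sum_split_Compl[of _ A] inner_commute a_def c_def)
  have gD: "- (g \<bullet> D) \<le> norm g * N"
    using Cauchy_Schwarz_ineq2[of g "restrict_vec D B"]
    unfolding g[of D] norm_restrict_vec N_def by linarith
  have energy: "D \<bullet> (K *v D) \<le> 5 / 8 * lam * a - 3 / 8 * lam * c + norm g * N"
  proof -
    have "lam / 8 * (a + c) + lam / 2 * (a - c) = 5 / 8 * lam * a - 3 / 8 * lam * c"
      by (simp add: field_simps)
    moreover have "D \<bullet> (K *v D) \<le> (V \<bullet> D - g \<bullet> D) + lam / 2 * (a - c)"
      using total_energy unfolding a_def[symmetric] c_def[symmetric] inner_diff_left[of V g] .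
    ultimately show ?thesis using VD gD by linarith
  qed
  have "5 / 8 * lam * a \<le> 5 / 8 * lam * (P * N)" using aN lam_pos by (intro mult_left_mono) auto
  note energy = energy this
  have "(\<Sum>j\<in>- B. \<bar>D $ j\<bar>) \<le> \<rho> * N"
  proof -
    have "3 / 8 * lam * c \<le> 5 / 8 * lam * (P * N) + norm g * N"
      using energy K_nonneg[of D] by linarith
    also have "\<dots> \<le> 3 / 2 * lam * (P * N) + 3 / 2 * norm g * N"
      using lam_pos P N by (intro add_mono mult_right_mono) auto
    also have "\<dots> = 3 / 8 * lam * (\<rho> * N)"
      using lam_pos by (simp add: \<rho> P_def field_simps)
    finally have "c \<le> \<rho> * N" using lam_pos by simp
    moreover have "(\<Sum>j\<in>- B. \<bar>D $ j\<bar>) \<le> c"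
      unfolding c_def using B by (intro sum_mono2) auto
    ultimately show ?thesis by simp
  qed
  then have "\<phi>' * N\<^sup>2 \<le> D \<bullet> (K *v D)"
    using RE unfolding N2 unfolding N_def by blast
  moreover have "0 \<le> 3 / 8 * lam * c" using lam_pos by (simp add: c_def sum_nonneg)
  moreover have "5 / 8 * lam * (P * N) \<le> lam * (P * N)"
    using lam_pos P N by (intro mult_right_mono) auto
  ultimately have "N * (\<phi>' * N) \<le> N * (lam * P + norm g)"
    using energy by (simp add: algebra_simps power2_eq_square)
  then have "\<phi>' * N \<le> lam * P + norm g"
    using N P lam_pos by (cases "N = 0") auto
  also have "\<dots> < \<phi>' * \<bar>bs $ j\<bar>" using beta_min[OF j] by (simp add: P_def)
  finally have "N < \<bar>bs $ j\<bar>" using \<phi>' by simp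
  moreover have "\<bar>D $ j\<bar> \<le> N"
    using j B member_le_sum[of j B "\<lambda>j. (D $ j)\<^sup>2"]
    unfolding N_def by (intro real_le_rsqrt) auto
  ultimately show ?thesis by (intro sgn_eq_if_close) auto
qed

section \<open>Gaussian concentration of the score\<close>

text \<open>Completing the square turns \<open>exp (s * x)\<close> times the centred normal density into a constant
  multiple of the normal density with mean \<open>s * \<sigma>\<^sup>2\<close>, which has total mass one.\<close>

lemma (in prob_space) nn_integral_exp_normal:
  fixes Z :: "'a \<Rightarrow> real"
  assumes Z: "distributed M lborel Z (normal_density 0 \<sigma>)" and \<sigma>: "\<sigma> > 0"
  shows "(\<integral>\<^sup>+\<omega>. ennreal (exp (s * Z \<omega>)) \<partial>M) = ennreal (exp (s\<^sup>2 * \<sigma>\<^sup>2 / 2))"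
proof -
  have "(\<integral>\<^sup>+\<omega>. ennreal (exp (s * Z \<omega>)) \<partial>M)
      = (\<integral>\<^sup>+x. ennreal (normal_density 0 \<sigma> x) * ennreal (exp (s * x)) \<partial>lborel)"
    by (rule distributed_nn_integral[OF Z, symmetric]) simp
  also have "\<dots> = (\<integral>\<^sup>+x. ennreal (exp (s\<^sup>2 * \<sigma>\<^sup>2 / 2)) * ennreal (normal_density (s * \<sigma>\<^sup>2) \<sigma> x) \<partial>lborel)"
  proof (rule nn_integral_cong)
    fix x :: real
    have "- x\<^sup>2 / (2 * \<sigma>\<^sup>2) + s * x = s\<^sup>2 * \<sigma>\<^sup>2 / 2 + - (x - s * \<sigma>\<^sup>2)\<^sup>2 / (2 * \<sigma>\<^sup>2)"
      using \<sigma> by (simp add: field_simps power2_eq_square)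
    then have "normal_density 0 \<sigma> x * exp (s * x)
        = exp (s\<^sup>2 * \<sigma>\<^sup>2 / 2) * normal_density (s * \<sigma>\<^sup>2) \<sigma> x"
      by (simp add: normal_density_def flip: exp_add)
    then show "ennreal (normal_density 0 \<sigma> x) * ennreal (exp (s * x))
        = ennreal (exp (s\<^sup>2 * \<sigma>\<^sup>2 / 2)) * ennreal (normal_density (s * \<sigma>\<^sup>2) \<sigma> x)"
      by (simp flip: ennreal_mult)
  qed
  also have "\<dots> = ennreal (exp (s\<^sup>2 * \<sigma>\<^sup>2 / 2))"
    using \<sigma> by (simp add: nn_integral_cmult nn_integral_eq_integral)
  finally show ?thesis .
qed

text \<open>Chernoff's bound: the exponential moment of the combination factorises by independence. Going
  through exponential moments rather than the law of the combination allows some of the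
  coefficients to be zero, as entries of a design matrix may be.\<close>

lemma (in prob_space) normal_combination_upper_tail:
  fixes Z :: "'i \<Rightarrow> 'a \<Rightarrow> real"
  assumes I: "finite I" and indep: "indep_vars (\<lambda>_. borel) Z I"
    and Z: "\<And>i. i \<in> I \<Longrightarrow> distributed M lborel (Z i) (normal_density 0 \<sigma>)"
    and \<sigma>: "\<sigma> > 0" and v: "v = (\<Sum>i\<in>I. (a i)\<^sup>2)" "v > 0" and c: "c > 0"
  shows "prob {\<omega>\<in>space M. (\<Sum>i\<in>I. a i * Z i \<omega>) \<ge> c} \<le> exp (- (c\<^sup>2 / (2 * \<sigma>\<^sup>2 * v)))"
proof -
  \<comment> \<open>the minimiser of the Chernoff exponent \<open>s\<^sup>2 * \<sigma>\<^sup>2 * v / 2 - s * c\<close>\<close>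
  define s where "s = c / (\<sigma>\<^sup>2 * v)"
  have s: "s > 0" using \<sigma> v(2) c by (simp add: s_def)
  have [measurable]: "Z i \<in> borel_measurable M" if "i \<in> I" for i
    using indep that by (auto simp: indep_vars_def)
  have "ennreal (prob {\<omega>\<in>space M. (\<Sum>i\<in>I. a i * Z i \<omega>) \<ge> c})
      = emeasure M {\<omega>\<in>space M. (\<Sum>i\<in>I. a i * Z i \<omega>) \<ge> c}"
    by (simp add: emeasure_eq_measure)
  also have "\<dots> \<le> ennreal (exp (- s * c)) *
      (\<integral>\<^sup>+\<omega>\<in>space M. ennreal (exp (s * (\<Sum>i\<in>I. a i * Z i \<omega>))) \<partial>M)"
    by (intro Chernoff_ineq_nn_integral_ge s) auto
  also have "(\<integral>\<^sup>+\<omega>\<in>space M. ennreal (exp (s * (\<Sum>i\<in>I. a i * Z i \<omega>))) \<partial>M)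
      = (\<integral>\<^sup>+\<omega>. (\<Prod>i\<in>I. ennreal (exp ((s * a i) * Z i \<omega>))) \<partial>M)"
    by (intro nn_integral_cong)
       (simp_all add: sum_distrib_left exp_sum I prod_ennreal mult.assoc)
  also have "\<dots> = (\<Prod>i\<in>I. \<integral>\<^sup>+\<omega>. ennreal (exp ((s * a i) * Z i \<omega>)) \<partial>M)"
    by (intro indep_vars_nn_integral I indep_vars_compose2[OF indep]) auto
  also have "\<dots> = (\<Prod>i\<in>I. ennreal (exp ((s * a i)\<^sup>2 * \<sigma>\<^sup>2 / 2)))"
    by (intro prod.cong refl nn_integral_exp_normal Z \<sigma>)
  also have "\<dots> = ennreal (exp (s\<^sup>2 * \<sigma>\<^sup>2 * v / 2))"
    by (simp add: prod_ennreal v(1) I power_mult_distrib sum_distrib_left mult_ac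
        flip: exp_sum sum_divide_distrib)
  also have "ennreal (exp (- s * c)) * \<dots> = ennreal (exp (- s * c + s\<^sup>2 * \<sigma>\<^sup>2 * v / 2))"
    by (simp flip: ennreal_mult exp_add)
  also have "- s * c + s\<^sup>2 * \<sigma>\<^sup>2 * v / 2 = - (c\<^sup>2 / (2 * \<sigma>\<^sup>2 * v))"
    using \<sigma> v(2) by (simp add: s_def field_simps power2_eq_square)
  finally show ?thesis
    by (simp add: ennreal_le_iff)
qed

lemma (in prob_space) normal_combination_tail:
  fixes Z :: "'i \<Rightarrow> 'a \<Rightarrow> real"
  assumes I: "finite I" and indep: "indep_vars (\<lambda>_. borel) Z I"
    and Z: "\<And>i. i \<in> I \<Longrightarrow> distributed M lborel (Z i) (normal_density 0 \<sigma>)"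
    and \<sigma>: "\<sigma> > 0" and v: "v = (\<Sum>i\<in>I. (a i)\<^sup>2)" "v > 0" and c: "c > 0"
  shows "prob {\<omega>\<in>space M. \<bar>\<Sum>i\<in>I. a i * Z i \<omega>\<bar> \<ge> c} \<le> 2 * exp (- (c\<^sup>2 / (2 * \<sigma>\<^sup>2 * v)))"
proof -
  let ?up = "{\<omega>\<in>space M. (\<Sum>i\<in>I. a i * Z i \<omega>) \<ge> c}"
  let ?down = "{\<omega>\<in>space M. (\<Sum>i\<in>I. - a i * Z i \<omega>) \<ge> c}"
  have [measurable]: "Z i \<in> borel_measurable M" if "i \<in> I" for i
    using indep that by (auto simp: indep_vars_def)
  have sets: "?up \<in> events" "?down \<in> events" by measurable
  have "{\<omega>\<in>space M. \<bar>\<Sum>i\<in>I. a i * Z i \<omega>\<bar> \<ge> c} \<subseteq> ?up \<union> ?down"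
    by (auto simp: sum_negf abs_if split: if_splits)
  then have "prob {\<omega>\<in>space M. \<bar>\<Sum>i\<in>I. a i * Z i \<omega>\<bar> \<ge> c} \<le> prob (?up \<union> ?down)"
    by (intro finite_measure_mono sets.Un sets)
  also have "\<dots> \<le> prob ?up + prob ?down"
    by (intro measure_Un_le sets)
  also have "\<dots> \<le> exp (- (c\<^sup>2 / (2 * \<sigma>\<^sup>2 * v))) + exp (- (c\<^sup>2 / (2 * \<sigma>\<^sup>2 * v)))"
    by (intro add_mono normal_combination_upper_tail I indep Z \<sigma> v c) (auto simp: v)
  finally show ?thesis by simp
qed

text \<open>With normalised columns every coordinate of the score is a combination of the noise whose
  squared coefficients add up to \<open>1 / n\<close>, so the same Gaussian tail applies to all of them.\<close>

lemma (in prob_space) score_uniform_tail: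
  fixes X :: "real ^ 'p ^ 'n" and \<epsilon> :: "'a \<Rightarrow> real ^ 'n"
  assumes X: "\<And>j. (\<Sum>i\<in>UNIV. (X $ i $ j)\<^sup>2) / real CARD('n) = 1"
    and indep: "indep_vars (\<lambda>_. borel) (\<lambda>i \<omega>. \<epsilon> \<omega> $ i) UNIV"
    and \<epsilon>: "\<And>i. distributed M lborel (\<lambda>\<omega>. \<epsilon> \<omega> $ i) (normal_density 0 \<sigma>)"
    and \<sigma>: "\<sigma> > 0" and c: "c > 0"
  shows "{\<omega>\<in>space M. \<exists>j. c \<le> \<bar>score X (\<epsilon> \<omega>) $ j\<bar>} \<in> events" (is "?E \<in> _")
    and "prob {\<omega>\<in>space M. \<exists>j. c \<le> \<bar>score X (\<epsilon> \<omega>) $ j\<bar>}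
      \<le> 2 * real CARD('p) * exp (- (real CARD('n) * c\<^sup>2 / (2 * \<sigma>\<^sup>2)))"
proof -
  define n where "n = real CARD('n)"
  have n: "n > 0" by (simp add: n_def)
  let ?Ej = "\<lambda>j. {\<omega>\<in>space M. \<bar>\<Sum>i\<in>UNIV. X $ i $ j / n * \<epsilon> \<omega> $ i\<bar> \<ge> c}"
  have [measurable]: "(\<lambda>\<omega>. \<epsilon> \<omega> $ i) \<in> borel_measurable M" for i
    using indep by (auto simp: indep_vars_def)
  have sets: "?Ej j \<in> events" for j by measurable
  have E: "?E = (\<Union>j\<in>UNIV. ?Ej j)" by (auto simp: score_nth n_def)
  show "?E \<in> events" unfolding E using sets by (intro sets.finite_UN) auto
  have "prob (?Ej j) \<le> 2 * exp (- (n * c\<^sup>2 / (2 * \<sigma>\<^sup>2)))" for j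
  proof -
    have "(\<Sum>i\<in>UNIV. (X $ i $ j)\<^sup>2) = n"
      using X[of j] n by (simp add: n_def)
    then have v: "1 / n = (\<Sum>i\<in>UNIV. (X $ i $ j / n)\<^sup>2)"
      using n by (simp add: power_divide power2_eq_square flip: sum_divide_distrib)
    show ?thesis
      using normal_combination_tail[OF finite indep \<epsilon> \<sigma> v _ c] n by (simp add: mult.commute)
  qed
  then have "prob ?E \<le> (\<Sum>j\<in>(UNIV :: 'p set). 2 * exp (- (n * c\<^sup>2 / (2 * \<sigma>\<^sup>2))))"
    unfolding E using sets
    by (intro order_trans[OF finite_measure_subadditive_finite] sum_mono) auto
  then show "prob ?E \<le> 2 * real CARD('p) * exp (- (real CARD('n) * c\<^sup>2 / (2 * \<sigma>\<^sup>2)))"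
    by (simp add: n_def)
qed

section \<open>Recovery with high probability\<close>

theorem theorem4:
  fixes M :: "'w measure"
    and X :: "real ^ 'p ^ 'n" and J :: "real ^ 'p ^ 'd"
    and \<beta>s :: "real ^ 'p" and \<epsilon> Y :: "'w \<Rightarrow> real ^ 'n" and \<beta>h :: "'w \<Rightarrow> real ^ 'p"
    and \<sigma> \<eta> lam \<mu> \<phi> \<phi>' \<rho> ct cJ t :: real
    and m :: nat and B :: "'p set" and C :: "'w \<Rightarrow> 'p set"
  assumes "prob_space M"
    and columns_normalized: "\<forall>j. (\<Sum>i\<in>UNIV. (X $ i $ j)\<^sup>2) / real CARD('n) = 1"
    and "\<sigma> > 0"
    and noise_indep: "prob_space.indep_vars M (\<lambda>_. borel) (\<lambda>i \<omega>. \<epsilon> \<omega> $ i) UNIV"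
    and noise_gaussian: "\<forall>i. distributed M lborel (\<lambda>\<omega>. \<epsilon> \<omega> $ i) (normal_density 0 \<sigma>)"
    and model: "\<forall>\<omega>\<in>space M. Y \<omega> = X *v \<beta>s + \<epsilon> \<omega>"
    and estimator_measurable: "\<beta>h \<in> borel_measurable M"
    and estimator: "\<forall>\<omega>\<in>space M. is_quad_solution X J lam \<mu> (Y \<omega>) (\<beta>h \<omega>)"
    and "0 < \<eta>" and "\<eta> < 1"
    and "gram J *v \<beta>s \<noteq> 0"
    and lambda: "lam = 16 * \<sigma> *
          sqrt (ln (real CARD('p) / sqrt (\<eta> * real CARD('p) / (1 + real CARD('p)))) / real CARD('n))"
    and mu: "\<mu> = lam / (4 * infnorm (gram J *v \<beta>s))"
    and "\<phi> > 0"
    and RE: "\<forall>\<Delta>. (\<Sum>j\<in>- support \<beta>s. \<bar>\<Delta> $ j\<bar>) \<le> 4 * (\<Sum>j\<in>support \<beta>s. \<bar>\<Delta> $ j\<bar>) \<longrightarrow>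
          \<Delta> \<bullet> (K_mat X J \<mu> *v \<Delta>) \<ge> \<phi> * (\<Sum>j\<in>support \<beta>s. (\<Delta> $ j)\<^sup>2)"
    and rho: "\<rho> = 4 * sqrt (card (support \<beta>s)) + 4 * \<mu> / lam * norm (gram J *v \<beta>s)"
    and "m \<ge> 1" and "\<phi>' > 0"
    and "support \<beta>s \<subseteq> B"
    and "cJ \<ge> 1" and "card B \<le> cJ * card (support \<beta>s)"
    and "\<forall>u. \<beta>s \<bullet> (gram J *v u) = restrict_vec \<beta>s B \<bullet> (gram J *v restrict_vec u B)"
    and "m + card B < CARD('p)"
    and "\<forall>\<omega>\<in>space M. largest_outside m (\<beta>s - \<beta>h \<omega>) B (C \<omega>)"
    and RE': "\<forall>\<omega>\<in>space M. \<forall>\<Delta>.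
          (\<Sum>j\<in>- B. \<bar>\<Delta> $ j\<bar>) \<le> \<rho> * sqrt (\<Sum>j\<in>B. (\<Delta> $ j)\<^sup>2) \<longrightarrow>
          \<Delta> \<bullet> (K_mat X J \<mu> *v \<Delta>) \<ge> \<phi>' * (\<Sum>j\<in>B \<union> C \<omega>. (\<Delta> $ j)\<^sup>2)"
    and ct: "ct = 2 * inverse \<phi>' * (1 + \<rho> / sqrt m)"
    and beta_min: "(MIN j\<in>support \<beta>s. \<bar>\<beta>s $ j\<bar>) >
          2 * ct * (lam * sqrt (card (support \<beta>s)) + \<mu> * norm (gram J *v \<beta>s))"
    and "0 < t" and "t < \<phi> / 64"
    and coherence: "(MAX j\<in>support \<beta>s. MAX k\<in>- support \<beta>s. \<bar>K_mat X J \<mu> $ j $ k\<bar>)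
          \<le> t / card (support \<beta>s)"
  shows "\<P>(\<omega> in M. \<not> support (\<beta>h \<omega>) \<subseteq> support \<beta>s) \<le> \<eta>
    \<and> \<P>(\<omega> in M. sign_vec (\<beta>h \<omega>) = sign_vec \<beta>s) \<ge> 1 - \<eta>"
proof -
  interpret prob_space M by fact
  define n p where "n = real CARD('n)" and "p = real CARD('p)"
  have n: "n > 0" and p: "p \<ge> 1" by (simp_all add: n_def p_def Suc_leI)
  define L where "L = ln (p / sqrt (\<eta> * p / (1 + p)))"
  have "\<eta> * p < 1 + p" using p \<open>\<eta> < 1\<close> mult_strict_right_mono[of \<eta> 1 p] by linarith
  then have ratio: "0 < \<eta> * p / (1 + p)" "\<eta> * p / (1 + p) < 1"
    using p \<open>0 < \<eta>\<close> by (simp_all add: divide_less_eq)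
  have arg: "p / sqrt (\<eta> * p / (1 + p)) > 1"
  proof -
    have "0 < sqrt (\<eta> * p / (1 + p))" "sqrt (\<eta> * p / (1 + p)) < 1"
      using ratio by (simp_all only: real_sqrt_gt_0_iff real_sqrt_lt_1_iff)
    then show ?thesis using p by (subst less_divide_eq_1_pos) linarith+
  qed
  have L: "L > 0" using arg by (simp add: L_def)
  have lam_eq: "lam = 16 * \<sigma> * sqrt (L / n)" by (simp add: lambda L_def n_def p_def)
  have lam: "lam > 0" using lam_eq L n \<open>\<sigma> > 0\<close> by simp
  define J0 where "J0 = infnorm (gram J *v \<beta>s)"
  have J0: "J0 > 0" using \<open>gram J *v \<beta>s \<noteq> 0\<close> by (simp add: J0_def infnorm_pos_lt)
  have \<mu>: "\<mu> > 0" using lam J0 by (simp add: mu J0_def)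

  \<comment> \<open>The threshold \<open>lam / 8 = 2 * \<sigma> * sqrt (L / n)\<close> gives the exponent \<open>2 * L\<close>. The factor \<open>1 + p\<close>
     inside the logarithm absorbs the factor \<open>2\<close> of the two-sided tail, since \<open>p \<ge> 1\<close>.\<close>
  define E where "E = {\<omega>\<in>space M. \<exists>j. lam / 8 \<le> \<bar>score X (\<epsilon> \<omega>) $ j\<bar>}"
  have lam8: "lam / 8 > 0" using lam by simp
  note tail = score_uniform_tail[of X \<epsilon> \<sigma> "lam / 8", OF columns_normalized[rule_format]
      noise_indep noise_gaussian[rule_format] \<open>\<sigma> > 0\<close> lam8]
  have E_events: "E \<in> events" unfolding E_def by (rule tail(1))
  have "prob E \<le> 2 * p * exp (- (n * (lam / 8)\<^sup>2 / (2 * \<sigma>\<^sup>2)))"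
    unfolding E_def n_def p_def by (rule tail(2))
  also have "n * (lam / 8)\<^sup>2 / (2 * \<sigma>\<^sup>2) = 2 * L"
    using n L \<open>\<sigma> > 0\<close> by (simp add: lam_eq power_mult_distrib power_divide field_simps)
  also have "exp (- (2 * L)) = \<eta> / (p * (1 + p))"
  proof -
    have "exp (- (2 * L)) = 1 / (exp L)\<^sup>2" by (simp add: exp_minus exp_double divide_inverse)
    also have "exp L = p / sqrt (\<eta> * p / (1 + p))" using arg by (simp add: L_def)
    also have "1 / (p / sqrt (\<eta> * p / (1 + p)))\<^sup>2 = (\<eta> * p / (1 + p)) / p\<^sup>2"
      using ratio by (simp add: power_divide)
    also have "\<dots> = \<eta> / (p * (1 + p))" using p by (simp add: power2_eq_square)
    finally show ?thesis .
  qed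
  also have "2 * p * (\<eta> / (p * (1 + p))) = 2 * \<eta> / (1 + p)" using p by simp
  also have "\<dots> \<le> \<eta>" using p \<open>0 < \<eta>\<close> by (simp add: field_simps)
  finally have prob_E: "prob E \<le> \<eta>" .

  define g where "g = \<mu> *\<^sub>R (gram J *v \<beta>s)"
  define R where "R = lam * sqrt (card (support \<beta>s)) + norm g"
  have norm_g: "norm g = \<mu> * norm (gram J *v \<beta>s)" using \<mu> by (simp add: g_def)
  have R: "R \<ge> 0" using lam by (simp add: R_def)
  have support_nonempty: "support \<beta>s \<noteq> {}"
    using \<open>gram J *v \<beta>s \<noteq> 0\<close>
    by (metis (mono_tags, lifting) Collect_empty_eq matrix_vector_mult_0_right support_def
        vec_eq_iff zero_index)
  have "B \<noteq> UNIV" using \<open>m + card B < CARD('p)\<close> by auto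
  then have compl_nonempty: "- support \<beta>s \<noteq> {}" using \<open>support \<beta>s \<subseteq> B\<close> by auto
  have s: "real (card (support \<beta>s)) > 0" using support_nonempty by (simp add: card_gt_0_iff)
  have g_bound: "\<bar>g $ j\<bar> \<le> lam / 4" for j
    using component_le_infnorm_cart[of "gram J *v \<beta>s" j] \<mu> lam J0
    by (simp add: g_def abs_mult mu J0_def[symmetric] field_simps)
  have g_B: "g \<bullet> u = g \<bullet> restrict_vec u B" for u
  proof -
    have sym: "g \<bullet> u = \<mu> * (\<beta>s \<bullet> (gram J *v u))" for u
      using inner_gram[of u J \<beta>s] inner_gram[of \<beta>s J u] by (simp add: g_def inner_commute)
    have "restrict_vec \<beta>s B = \<beta>s"
      using \<open>support \<beta>s \<subseteq> B\<close> by (auto simp: vec_eq_iff support_def)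
    then show ?thesis
      using \<open>\<forall>u. \<beta>s \<bullet> (gram J *v u) = restrict_vec \<beta>s B \<bullet> (gram J *v restrict_vec u B)\<close>
      by (simp add: sym)
  qed
  have entry_bound: "\<bar>K_mat X J \<mu> $ j $ k\<bar> \<le> t / card (support \<beta>s)"
    if "j \<in> support \<beta>s" "k \<notin> support \<beta>s" for j k
  proof -
    have "\<bar>K_mat X J \<mu> $ j $ k\<bar> \<le> (MAX k\<in>- support \<beta>s. \<bar>K_mat X J \<mu> $ j $ k\<bar>)"
      using that by (intro Max_ge) auto
    also have "\<dots> \<le> (MAX j\<in>support \<beta>s. MAX k\<in>- support \<beta>s. \<bar>K_mat X J \<mu> $ j $ k\<bar>)"
      using that by (intro Max_ge) auto
    finally show ?thesis using coherence by linarith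
  qed
  \<comment> \<open>\<open>2 * ct\<close> is at least \<open>4 / \<phi>'\<close>, more than the \<open>1 / \<phi>'\<close> that controls the error\<close>
  have signal: "R < \<phi>' * \<bar>\<beta>s $ j\<bar>" if "j \<in> support \<beta>s" for j
  proof -
    have "\<rho> \<ge> 0" using lam \<mu> by (simp add: rho)
    then have "1 / \<phi>' \<le> 2 * ct"
      using \<open>\<phi>' > 0\<close> by (simp add: ct divide_inverse)
    then have "1 / \<phi>' * R \<le> 2 * ct * R" using R by (rule mult_right_mono)
    also have "\<dots> < (MIN j\<in>support \<beta>s. \<bar>\<beta>s $ j\<bar>)" using beta_min by (simp add: R_def norm_g)
    also have "\<dots> \<le> \<bar>\<beta>s $ j\<bar>" using that by (intro Min_le) auto
    finally show ?thesis using \<open>\<phi>' > 0\<close> by (simp add: field_simps)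
  qed

  have good: "support (\<beta>h \<omega>) \<subseteq> support \<beta>s \<and> sign_vec (\<beta>h \<omega>) = sign_vec \<beta>s"
    if \<omega>: "\<omega> \<in> space M" "\<omega> \<notin> E" for \<omega>
  proof -
    define V where "V = score X (\<epsilon> \<omega>)"
    have V: "\<bar>V $ j\<bar> \<le> lam / 8" for j
      using \<omega> by (auto simp: E_def V_def not_le intro: less_imp_le)
    have sol: "is_quad_solution X J lam \<mu> (X *v \<beta>s + \<epsilon> \<omega>) (\<beta>h \<omega>)"
      using estimator model \<omega>(1) by auto
    interpret lasso_variational "K_mat X J \<mu>" "V - g" \<beta>s "\<beta>h \<omega>" lam
      using quad_solution_variational[OF sol] lam by unfold_locales (auto simp: V_def g_def)
    have w: "\<bar>(V - g) $ j\<bar> \<le> 3 / 8 * lam" for j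
      using V[of j] g_bound[of j] unfolding vector_minus_component by linarith
    have supp: "support (\<beta>h \<omega>) \<subseteq> support \<beta>s"
    proof (rule support_contained[where \<phi> = \<phi> and \<kappa> = "t / card (support \<beta>s)"])
      fix x :: "real ^ 'p" assume "support x \<subseteq> support \<beta>s"
      then have "(\<Sum>j\<in>- support \<beta>s. \<bar>x $ j\<bar>) = 0"
        by (intro sum.neutral) (auto simp: support_def)
      then show "\<phi> * (\<Sum>j\<in>support \<beta>s. (x $ j)\<^sup>2) \<le> x \<bullet> (K_mat X J \<mu> *v x)"
        using RE by (simp add: sum_nonneg)
    next
      show "x \<bullet> (K_mat X J \<mu> *v x) \<ge> 0" for x using \<mu> by (simp add: K_mat_nonneg)
    next
      show "transpose (K_mat X J \<mu>) = K_mat X J \<mu>" by (rule transpose_K_mat)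
    next
      show "\<bar>(V - g) $ j\<bar> \<le> 3 / 8 * lam" for j by (rule w)
    qed (use entry_bound support_nonempty s
        \<open>\<phi> > 0\<close> \<open>0 < t\<close> \<open>t < \<phi> / 64\<close> in auto)
    have "sgn (\<beta>h \<omega> $ j) = sgn (\<beta>s $ j)" for j
    proof (cases "j \<in> support \<beta>s")
      case True
      show ?thesis
      proof (rule lasso_signs[where K = "K_mat X J \<mu>" and V = V and g = g and lam = lam
            and bs = \<beta>s and B = B and \<rho> = \<rho> and \<phi>' = \<phi>'])
        assume "(\<Sum>j\<in>- B. \<bar>(\<beta>h \<omega> - \<beta>s) $ j\<bar>) \<le> \<rho> * sqrt (\<Sum>j\<in>B. ((\<beta>h \<omega> - \<beta>s) $ j)\<^sup>2)"
        then have "\<phi>' * (\<Sum>j\<in>B \<union> C \<omega>. ((\<beta>h \<omega> - \<beta>s) $ j)\<^sup>2)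
            \<le> (\<beta>h \<omega> - \<beta>s) \<bullet> (K_mat X J \<mu> *v (\<beta>h \<omega> - \<beta>s))"
          using RE' \<omega>(1) by blast
        moreover have "\<phi>' * (\<Sum>j\<in>B. ((\<beta>h \<omega> - \<beta>s) $ j)\<^sup>2)
            \<le> \<phi>' * (\<Sum>j\<in>B \<union> C \<omega>. ((\<beta>h \<omega> - \<beta>s) $ j)\<^sup>2)"
          using \<open>\<phi>' > 0\<close> by (intro mult_left_mono sum_mono2) auto
        ultimately show "\<phi>' * (\<Sum>j\<in>B. ((\<beta>h \<omega> - \<beta>s) $ j)\<^sup>2)
            \<le> (\<beta>h \<omega> - \<beta>s) \<bullet> (K_mat X J \<mu> *v (\<beta>h \<omega> - \<beta>s))" by linarith
      next
        show "g \<bullet> u = g \<bullet> restrict_vec u B" for u by (rule g_B)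
      next
        show "lasso_variational (K_mat X J \<mu>) (V - g) \<beta>s (\<beta>h \<omega>) lam" by unfold_locales
      next
        show "x \<bullet> (K_mat X J \<mu> *v x) \<ge> 0" for x using \<mu> by (simp add: K_mat_nonneg)
      next
        show "\<rho> = 4 * sqrt (card (support \<beta>s)) + 4 * norm g / lam" by (simp add: rho norm_g)
      next
        show "lam * sqrt (card (support \<beta>s)) + norm g < \<phi>' * \<bar>\<beta>s $ j\<bar>"
          if "j \<in> support \<beta>s" for j using signal[OF that] by (simp add: R_def)
      qed (use V True \<open>support \<beta>s \<subseteq> B\<close> \<open>\<phi>' > 0\<close> in auto)
    next
      case False
      then have "\<beta>h \<omega> $ j = 0" "\<beta>s $ j = 0" using supp by (auto simp: support_def)
      then show ?thesis by simp
    qed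
    then show ?thesis using supp by (simp add: sign_vec_def vec_eq_iff)
  qed

  have "\<P>(\<omega> in M. \<not> support (\<beta>h \<omega>) \<subseteq> support \<beta>s) \<le> prob E"
    using good by (intro finite_measure_mono E_events) blast
  moreover have "prob (space M - E) \<le> \<P>(\<omega> in M. sign_vec (\<beta>h \<omega>) = sign_vec \<beta>s)"
  proof (intro finite_measure_mono)
    have [measurable]: "(\<lambda>\<omega>. \<beta>h \<omega> $ j) \<in> borel_measurable M" for j
      by (rule borel_measurable_continuous_on[OF _ estimator_measurable])
        (intro continuous_intros)
    show "{\<omega>\<in>space M. sign_vec (\<beta>h \<omega>) = sign_vec \<beta>s} \<in> events"
      unfolding sign_vec_def vec_eq_iff vec_lambda_beta by measurable
    show "space M - E \<subseteq> {\<omega>\<in>space M. sign_vec (\<beta>h \<omega>) = sign_vec \<beta>s}" using good by blast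
  qed
  ultimately show ?thesis using prob_E prob_compl[OF E_events] by linarith
qed

end
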